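(* Let $n\ge 7$ and let $r_1,\dots,r_n\ge 3$ be integers. Let $H_n=H_n(r_1,\dots,r_n)=K_{r_1}\square\cdots\square K_{r_n}$ be the corresponding Hamming graph of dimension $n$, and let $c(H_n)$ be its $P_3$-Carathéodory number. \begin{enumerate} \item If $n\equiv 0 \pmod 3$, then $c(H_n)=3\cdot 2^{\frac n3-1}$. \item If $n\equiv 1 \pmod 3$, then $c(H_n)=4\cdot 2^{\frac{n-1}3-1}$. \item If $n\equiv 2 \pmod 3$, then $c(H_n)=5\cdot 2^{\frac{n-2}3-1}$. \end{enumerate}
   Context: All graphs are finite, simple and undirected. $K_r$ is the complete graph on $\{0,\dots,r-1\}$. The Hamming graph $H_n(r_1,\dots,r_n)=K_{r_1}\square\cdots\square K_{r_n}$ has as vertices the tuples $(x_1,\dots,x_n)$ with $0\le x_i\le r_i-1$; two vertices are adjacent iff they differ in exactly one coordinate. Its dimension is $n$. A set $S\subseteq V(G)$ is $P_3$-convex if every vertex of $V(G)\setminus S$ has at most one neighbor in $S$. The $P_3$-hull $\mathcal H(S)$ of $S\subseteq V(G)$ is the smallest $P_3$-convex set of $G$ containing $S$. The ($P_3$-)Carathéodory number $c(G)$ is the smallest integer $c$ such that for every $S\subseteq V(G)$ and every $p\in\mathcal H(S)$ there is $F\subseteq S$ with $|F|\le c$ and $p\in\mathcal H(F)$. Equivalently, $c(G)$ is the largest cardinality of a set $S\subseteq V(G)$ with $\mathcal H(S)\setminus\bigcup_{u\in S}\mathcal H(S\setminus\{u\})\ne\emptyset$. *)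

theory Defs
  imports "Graph_Theory.Pair_Digraph" "HOL-Library.FuncSet" "HOL.Hull"
begin

text \<open>A finite simple undirected graph is a \<^locale>\<open>pair_graph\<close>: finite vertex set,
  and a symmetric irreflexive arc relation on it.\<close>

definition hamming_graph :: "nat \<Rightarrow> (nat \<Rightarrow> nat) \<Rightarrow> (nat \<Rightarrow> nat) pair_pre_digraph" where
  "hamming_graph n r =
    (let V = (\<Pi>\<^sub>E i\<in>{1..n}. {0..<r i})
     in \<lparr> pverts = V, parcs = {(x, y). x \<in> V \<and> y \<in> V \<and> (\<exists>!i. i \<in> {1..n} \<and> x i \<noteq> y i)} \<rparr>)"

definition P3_convex :: "'a pair_pre_digraph \<Rightarrow> 'a set \<Rightarrow> bool" where
  "P3_convex G S \<longleftrightarrow>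
    S \<subseteq> pverts G \<and> (\<forall>v \<in> pverts G - S. card {u \<in> S. (v, u) \<in> parcs G} \<le> 1)"

definition P3_hull :: "'a pair_pre_digraph \<Rightarrow> 'a set \<Rightarrow> 'a set" where
  "P3_hull G S = P3_convex G hull S"

definition caratheodory_number :: "'a pair_pre_digraph \<Rightarrow> nat" where
  "caratheodory_number G =
    (LEAST c. \<forall>S p. S \<subseteq> pverts G \<and> p \<in> P3_hull G S \<longrightarrow>
      (\<exists>F \<subseteq> S. finite F \<and> card F \<le> c \<and> p \<in> P3_hull G F))"

lemma pair_graph_hamming_graph: "pair_graph (hamming_graph n r)"
proof -
  define V where "V = (\<Pi>\<^sub>E i\<in>{1..n}. {0..<r i})"
  define A where "A = {(x, y). x \<in> V \<and> y \<in> V \<and> (\<exists>!i. i \<in> {1..n} \<and> x i \<noteq> y i)}"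
  have G: "hamming_graph n r = \<lparr> pverts = V, parcs = A \<rparr>"
    by (simp add: hamming_graph_def V_def A_def Let_def)
  have fV: "finite V" unfolding V_def by (intro finite_PiE) auto
  have sub: "A \<subseteq> V \<times> V" unfolding A_def by auto
  have fA: "finite A" using fV sub by (meson finite_SigmaI finite_subset)
  have symA: "sym A"
  proof (rule symI)
    fix x y assume "(x, y) \<in> A"
    moreover have "(\<lambda>i. i \<in> {1..n} \<and> y i \<noteq> x i) = (\<lambda>i. i \<in> {1..n} \<and> x i \<noteq> y i)"
      by metis
    ultimately show "(y, x) \<in> A" by (simp only: A_def mem_Collect_eq prod.case)
  qed
  have irr: "fst e \<noteq> snd e" if "e \<in> A" for e
    using that unfolding A_def by (cases e) auto
  show ?thesis unfolding G
  proof unfold_locales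
    show "symmetric (with_proj \<lparr>pverts = V, parcs = A\<rparr>)"
      using symA by (simp add: symmetric_def)
    show "fst e \<in> pverts \<lparr>pverts = V, parcs = A\<rparr>" "snd e \<in> pverts \<lparr>pverts = V, parcs = A\<rparr>"
      if "e \<in> parcs \<lparr>pverts = V, parcs = A\<rparr>" for e
      using that sub by auto
  qed (simp_all add: fV fA irr)
qed

text \<open>In a finite graph the hull really is the smallest convex set containing \<open>S\<close>
  (minimality is \<open>hull_minimal\<close>), and the minimum defining the Caratheodory number exists.\<close>

lemma P3_convex_P3_hull:
  assumes "finite (pverts G)" and "S \<subseteq> pverts G"
  shows "P3_convex G (P3_hull G S)"
proof -
  define \<C> where "\<C> = {C. P3_convex G C \<and> S \<subseteq> C}"
  have H: "P3_hull G S = \<Inter>\<C>" by (simp add: P3_hull_def hull_def \<C>_def)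
  have top: "pverts G \<in> \<C>" using assms by (auto simp: \<C>_def P3_convex_def)
  show ?thesis unfolding P3_convex_def
  proof (intro conjI ballI)
    show "P3_hull G S \<subseteq> pverts G" using H top by auto
    fix v assume v: "v \<in> pverts G - P3_hull G S"
    then obtain C where C: "C \<in> \<C>" "v \<notin> C" using H by auto
    then have cC: "P3_convex G C" by (simp add: \<C>_def)
    then have "finite C" using assms(1) finite_subset by (auto simp: P3_convex_def)
    then have "card {u \<in> P3_hull G S. (v, u) \<in> parcs G} \<le> card {u \<in> C. (v, u) \<in> parcs G}"
      using H C(1) by (intro card_mono) auto
    also have "\<dots> \<le> 1" using cC C(2) v by (auto simp: P3_convex_def)
    finally show "card {u \<in> P3_hull G S. (v, u) \<in> parcs G} \<le> 1" .
  qed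
qed

lemma caratheodory_number_works:
  assumes "finite (pverts G)" and "S \<subseteq> pverts G" and "p \<in> P3_hull G S"
  shows "\<exists>F \<subseteq> S. finite F \<and> card F \<le> caratheodory_number G \<and> p \<in> P3_hull G F"
proof -
  let ?P = "\<lambda>c. \<forall>S p. S \<subseteq> pverts G \<and> p \<in> P3_hull G S \<longrightarrow>
      (\<exists>F \<subseteq> S. finite F \<and> card F \<le> c \<and> p \<in> P3_hull G F)"
  have "?P (card (pverts G))"
    using assms(1) by (blast intro: card_mono finite_subset)
  then have "?P (caratheodory_number G)"
    unfolding caratheodory_number_def by (rule LeastI)
  then show ?thesis using assms by blast
qed

end

theory Submission
  imports Defs
begin

text \<open>Call a subcube the set of vertices obtained by fixing some coordinates and letting the
  others, the free ones, vary; its dimension is the number of free coordinates. Two vertices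
  that differ in at most two coordinates have as their hull the subcube in which these
  coordinates are free, and more generally two subcubes at distance at most \<open>2\<close> have as their
  hull the smallest subcube containing both. So the hull of a set arises by merging subcubes,
  starting with points.

  Upper bound. If \<open>p\<close> is in the hull of \<open>S\<close> and of no proper subset of \<open>S\<close>, then \<open>S\<close> is
  obtained by merging, and no element of \<open>S\<close> is in the hull of the others. This second
  property, independence, passes to subsets, so the size of \<open>S\<close> can be bounded along the
  merging. Let \<open>f m\<close> be the largest size in dimension \<open>m\<close>, and look at the last merge, of \<open>A\<close>
  and \<open>B\<close>, in dimension \<open>m\<close>. If the hull of \<open>A\<close> has codimension \<open>1\<close> or \<open>2\<close>, then one or two
  more points already span everything, so \<open>S\<close> exceeds \<open>A\<close> by that many points only. If both
  codimensions are at least \<open>3\<close>, the size is at most \<open>2 * f (m - 3)\<close>. Except for lines, which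
  gain nothing in the step to dimension \<open>2\<close>, the first case gives an increase by one or two in
  as many dimensions. This bounds \<open>f\<close> by \<open>1, 2, 2, 3, 4, 5\<close> for \<open>m = 0, \<dots>, 5\<close> and then by
  doubling in every three steps (\<open>independent_built_bound\<close>).

  Lower bound. A set \<open>S\<close> spanning a subcube is guarded in the coordinate \<open>d\<close> with respect to
  \<open>b\<close> if the hull of every \<open>S - {u}\<close> avoids the hyperplane \<open>x d = b d\<close>. Take two guarded sets
  of the same size in subcubes \<open>A\<close>, \<open>B\<close> of dimension \<open>m\<close> whose free coordinates are the same
  except that \<open>A\<close> has \<open>i\<close> and \<open>B\<close> has \<open>j\<close>, and which have different fixed values in two more
  coordinates \<open>d\<close> and \<open>e\<close>. If the sets are guarded in \<open>i\<close> and in \<open>j\<close>, the hyperplane for \<open>i\<close>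
  containing \<open>B\<close> and that for \<open>j\<close> containing \<open>A\<close>, then \<open>A\<close> and \<open>B\<close> are at distance \<open>2\<close> and
  merge, but after removing any point the rest stays at distance \<open>3\<close> and nothing merges. The
  union is thus guarded in \<open>d\<close> and in \<open>e\<close>, because a third value is left there: three more
  dimensions double the size (\<open>guarded_double\<close>). This starts from dimensions \<open>3\<close>, \<open>4\<close>, \<open>5\<close>
  with \<open>3\<close>, \<open>4\<close>, \<open>5\<close> points.\<close>

section \<open>The extremal function\<close>

text \<open>The values are \<open>1, 2, 2, 3, 4, 5, 6, 8, 10, 12, 16, 20, \<dots>\<close>. The closed form gives no integer
  in dimensions \<open>0\<close> and \<open>2\<close>, hence the separate treatment of dimensions below \<open>3\<close>.\<close>

definition max_size :: "nat \<Rightarrow> nat" where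
  "max_size m = (if m = 0 then 1 else if m < 3 then 2 else (3 + m mod 3) * 2 ^ (m div 3 - 1))"

lemma max_size_small [simp]: "max_size 0 = 1" "max_size (Suc 0) = 2" "max_size 2 = 2" "max_size 3 = 3"
  "max_size 4 = 4" "max_size 5 = 5"
  by (auto simp: max_size_def)

lemma max_size_add3:
  assumes "3 \<le> m"
  shows "max_size (m + 3) = 2 * max_size m"
proof -
  obtain k where "m = k + 3" using assms by (metis add.commute le_Suc_ex)
  moreover have "(6 + k) mod 3 = k mod 3" "(6 + k) div 3 = k div 3 + 2" by presburger+
  ultimately show ?thesis by (simp add: max_size_def)
qed

lemma double_max_size_le:
  assumes "1 \<le> m"
  shows "2 * max_size m \<le> max_size (m + 3)"
proof (cases "m < 3")
  case True
  then have "m = 1 \<or> m = 2" using assms by auto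
  then show ?thesis by (auto simp: max_size_def)
next
  case False
  then show ?thesis using max_size_add3[of m] by simp
qed

text \<open>Dimension \<open>1\<close> is a real exception, as \<open>max_size 1 = max_size 2\<close>; it is the reason why lines
  need an argument of their own in the upper bound.\<close>

lemma max_size_Suc:
  assumes "m \<ge> 2"
  shows "max_size m + 1 \<le> max_size (m + 1)"
proof -
  have "max_size (3 * q + 3 + s) + 1 \<le> max_size (3 * q + 3 + s + 1)" if "s < 3" for q s
  proof -
    have e: "max_size (3 * q + 3 + s) = (3 + s) * 2 ^ q" if "s < 3" for s
    proof -
      have "3 * q + 3 + s = s + 3 * (q + 1)" by simp
      then have "(3 * q + 3 + s) mod 3 = s" "(3 * q + 3 + s) div 3 = q + 1" using that
        by (simp_all only: mod_mult_self2 div_mult_self2 mod_less div_less zero_less_numeral)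
      then show ?thesis by (simp add: max_size_def)
    qed
    have "max_size (3 * q + 3 + s + 1) = (4 + s) * 2 ^ q"
    proof (cases "s = 2")
      case True
      have "3 * q + 3 + s + 1 = 3 * (q + 2)" using True by simp
      then show ?thesis using True by (simp add: max_size_def)
    next
      case False
      then show ?thesis using e[of "s + 1"] that by (simp add: add.assoc)
    qed
    then show ?thesis using e[OF that] by (simp add: algebra_simps)
  qed
  moreover have "m = 2 \<or> (\<exists>q s. m = 3 * q + 3 + s \<and> s < 3)"
  proof (cases "m = 2")
    case False
    then have "m = 3 * ((m - 3) div 3) + 3 + (m - 3) mod 3" using assms
      div_mult_mod_eq[of "m - 3" 3] False by linarith
    then show ?thesis by (metis mod_less_divisor zero_less_numeral)
  qed simp
  moreover have "max_size 2 + 1 \<le> max_size (2 + 1)" by (simp add: max_size_def)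
  ultimately show ?thesis by metis
qed

lemma max_size_mono: "mono max_size"
proof -
  have "max_size m \<le> max_size (Suc m)" for m
  proof (cases "m \<ge> 2")
    case True then show ?thesis using max_size_Suc[of m] by simp
  next
    case False
    then have "m = 0 \<or> m = 1" by auto
    then show ?thesis by (auto simp: max_size_def)
  qed
  then show ?thesis by (simp add: mono_iff_le_Suc)
qed

section \<open>Two further values in a coordinate\<close>

text \<open>Since all \<open>r i \<ge> 3\<close>, the values \<open>0, 1, 2\<close> are available in every coordinate; \<open>alt1 v\<close> and
  \<open>alt2 v\<close> are two of them that differ from each other and from \<open>v\<close>.\<close>

definition alt1 :: "nat \<Rightarrow> nat" where "alt1 v = (if v = 0 then 1 else 0)"
definition alt2 :: "nat \<Rightarrow> nat" where "alt2 v = (if v = 2 then 1 else 2)"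
definition shift1 :: "(nat \<Rightarrow> nat) \<Rightarrow> nat set \<Rightarrow> nat \<Rightarrow> nat" where
  "shift1 b D = (\<lambda>i. if i \<in> D then alt1 (b i) else b i)"
definition shift2 :: "(nat \<Rightarrow> nat) \<Rightarrow> nat set \<Rightarrow> nat \<Rightarrow> nat" where
  "shift2 b D = (\<lambda>i. if i \<in> D then alt2 (b i) else b i)"

lemma alt_neq: "alt1 v \<noteq> v" "alt2 v \<noteq> v" "alt1 v \<noteq> alt2 v"
  by (auto simp: alt1_def alt2_def)

lemma shift_neq: "d \<in> D \<Longrightarrow> shift1 b D d \<noteq> b d" "d \<in> D \<Longrightarrow> shift2 b D d \<noteq> b d"
  "d \<in> D \<Longrightarrow> shift1 b D d \<noteq> shift2 b D d"
  unfolding shift1_def shift2_def using alt_neq by simp_all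

lemma shift_eq: "d \<notin> D \<Longrightarrow> shift1 b D d = b d" "d \<notin> D \<Longrightarrow> shift2 b D d = b d"
  unfolding shift1_def shift2_def by simp_all

section \<open>Convexity in Hamming graphs\<close>

locale hamming =
  fixes n :: nat and r :: "nat \<Rightarrow> nat"
  assumes r3: "i \<in> {1..n} \<Longrightarrow> 3 \<le> r i"
begin

definition V :: "(nat \<Rightarrow> nat) set" where
  "V = (\<Pi>\<^sub>E i\<in>{1..n}. {0..<r i})"

abbreviation convex :: "(nat \<Rightarrow> nat) set \<Rightarrow> bool" where
  "convex \<equiv> P3_convex (hamming_graph n r)"

abbreviation H :: "(nat \<Rightarrow> nat) set \<Rightarrow> (nat \<Rightarrow> nat) set" where
  "H \<equiv> P3_hull (hamming_graph n r)"

definition diff :: "(nat \<Rightarrow> nat) \<Rightarrow> (nat \<Rightarrow> nat) \<Rightarrow> nat set" where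
  "diff x y = {i \<in> {1..n}. x i \<noteq> y i}"

lemma pverts_hamming [simp]: "pverts (hamming_graph n r) = V"
  by (simp add: hamming_graph_def V_def Let_def)

lemma finite_V: "finite V"
  unfolding V_def by (intro finite_PiE) auto

lemma finite_diff [simp]: "finite (diff x y)"
  by (simp add: diff_def)

lemma diff_subset: "diff x y \<subseteq> {1..n}"
  by (auto simp: diff_def)

lemma diff_sym: "diff x y = diff y x"
  by (auto simp: diff_def)

lemma in_diff_iff: "i \<in> diff x y \<longleftrightarrow> i \<in> {1..n} \<and> x i \<noteq> y i"
  by (simp add: diff_def)

lemma diff_triangle: "diff x y \<subseteq> diff x z \<union> diff z y"
  by (auto simp: diff_def)

lemma diff_empty: "x \<in> V \<Longrightarrow> y \<in> V \<Longrightarrow> diff x y = {} \<longleftrightarrow> x = y"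
  unfolding V_def diff_def using PiE_ext[of x "{1..n}" _ y] by blast

text \<open>For constructing vertices by mixing the coordinates of two given ones.\<close>

lemma V_cong: "a \<in> V \<Longrightarrow> b \<in> V \<Longrightarrow> (\<And>i. x i = a i \<or> x i = b i) \<Longrightarrow> x \<in> V"
  unfolding V_def PiE_iff extensional_def mem_Collect_eq by metis

lemma shift_in_V:
  assumes "b \<in> V" "D \<subseteq> {1..n}"
  shows "shift1 b D \<in> V" "shift2 b D \<in> V"
proof -
  have "alt1 v < r i \<and> alt2 v < r i" if "i \<in> D" for i v
    using r3[of i] that assms(2) by (auto simp: alt1_def alt2_def simp del: One_nat_def)
  then show "shift1 b D \<in> V" "shift2 b D \<in> V"
    using assms unfolding V_def PiE_iff extensional_def shift1_def shift2_def by auto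
qed

lemma diff_shift:
  assumes "D \<subseteq> {1..n}"
  shows "diff (shift1 b D) b = D" "diff (shift2 b D) b = D" "diff (shift1 b D) (shift2 b D) = D"
  using assms alt_neq unfolding diff_def shift1_def shift2_def by (auto split: if_splits)

lemma parcs_hamming: "(x, y) \<in> parcs (hamming_graph n r) \<longleftrightarrow> x \<in> V \<and> y \<in> V \<and> card (diff x y) = 1"
proof -
  have "card (diff x y) = 1 \<longleftrightarrow> (\<exists>!i. i \<in> {1..n} \<and> x i \<noteq> y i)"
    unfolding card_1_singleton_iff diff_def by (smt (verit) One_nat_def card_1_singleton_iff ex1I mem_Collect_eq singletonD singletonI subsetI subset_antisym)
  then show ?thesis by (simp add: hamming_graph_def V_def Let_def)
qed

text \<open>Cardinality-free form: convexity is closure under adding a vertex with two distinct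
  neighbours in the set.\<close>

lemma convex_iff:
  "convex C \<longleftrightarrow> C \<subseteq> V \<and>
     (\<forall>z \<in> V. \<forall>x \<in> C. \<forall>y \<in> C. card (diff z x) = 1 \<and> card (diff z y) = 1 \<and> x \<noteq> y \<longrightarrow> z \<in> C)"
proof -
  have "card {u \<in> C. (v, u) \<in> parcs (hamming_graph n r)} \<le> 1 \<longleftrightarrow>
      (\<forall>x\<in>C. \<forall>y\<in>C. card (diff v x) = 1 \<and> card (diff v y) = 1 \<longrightarrow> x = y)"
    if "C \<subseteq> V" "v \<in> V" for v
  proof -
    have "finite C" using that finite_V finite_subset by blast
    then have "finite {u \<in> C. (v, u) \<in> parcs (hamming_graph n r)}" by simp
    then show ?thesis using that
      by (auto simp: card_le_Suc0_iff_eq parcs_hamming)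
  qed
  then show ?thesis unfolding P3_convex_def pverts_hamming by (smt (verit) DiffE DiffI)
qed

lemma convex_step:
  "convex C \<Longrightarrow> z \<in> V \<Longrightarrow> x \<in> C \<Longrightarrow> y \<in> C \<Longrightarrow> card (diff z x) = 1 \<Longrightarrow> card (diff z y) = 1 \<Longrightarrow> x \<noteq> y
   \<Longrightarrow> z \<in> C"
  unfolding convex_iff by blast

lemma convex_subset: "convex C \<Longrightarrow> C \<subseteq> V"
  by (simp add: convex_iff)

lemma convex_H: "S \<subseteq> V \<Longrightarrow> convex (H S)"
  using P3_convex_P3_hull finite_V pverts_hamming by metis

lemma subset_H: "S \<subseteq> H S"
  unfolding P3_hull_def by (rule hull_subset)

lemma H_minimal: "S \<subseteq> C \<Longrightarrow> convex C \<Longrightarrow> H S \<subseteq> C"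
  unfolding P3_hull_def by (rule hull_minimal)

lemma H_mono: "S \<subseteq> T \<Longrightarrow> H S \<subseteq> H T"
  unfolding P3_hull_def by (rule hull_mono)

text \<open>In contrast to the condition that some point of the hull of \<open>S\<close> needs all of \<open>S\<close>, this one
  is inherited by subsets, which is what an induction along a merging process requires.\<close>

definition independent :: "(nat \<Rightarrow> nat) set \<Rightarrow> bool" where
  "independent S \<longleftrightarrow> (\<forall>u \<in> S. u \<notin> H (S - {u}))"

lemma independent_subset: "independent S \<Longrightarrow> T \<subseteq> S \<Longrightarrow> independent T"
  unfolding independent_def by (meson Diff_mono H_mono subset_iff subset_refl)

text \<open>An element of \<open>S\<close> outside \<open>T\<close> would be in the hull of the remaining elements.\<close>

lemma independent_spanned:
  assumes "independent S" "T \<subseteq> S" "S \<subseteq> H T"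
  shows "S = T"
proof (rule ccontr)
  assume "S \<noteq> T"
  then obtain u where u: "u \<in> S" "u \<notin> T" using assms by blast
  then have "H T \<subseteq> H (S - {u})" using assms by (intro H_mono) auto
  then show False using u assms unfolding independent_def by blast
qed

section \<open>Subcubes and how they merge\<close>

definition subcube :: "nat set \<Rightarrow> (nat \<Rightarrow> nat) \<Rightarrow> (nat \<Rightarrow> nat) set" where
  "subcube I a = {x \<in> V. diff x a \<subseteq> I}"

lemma subcube_subset: "subcube I a \<subseteq> V"
  by (auto simp: subcube_def)

lemma in_subcube_iff: "x \<in> subcube I a \<longleftrightarrow> x \<in> V \<and> (\<forall>i \<in> {1..n} - I. x i = a i)"
  by (auto simp: subcube_def diff_def)

lemma self_in_subcube: "a \<in> V \<Longrightarrow> a \<in> subcube I a"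
  by (simp add: in_subcube_iff)

lemma subcube_mono: "I \<subseteq> J \<Longrightarrow> subcube I a \<subseteq> subcube J a"
  by (auto simp only: subcube_def)

lemma subcube_change_base: "diff a b \<subseteq> I \<Longrightarrow> subcube I a = subcube I b"
  using diff_triangle[of _ a b] diff_triangle[of _ b a] diff_sym[of a b] unfolding subcube_def by blast

lemma diff_subset_subcube: "x \<in> subcube I a \<Longrightarrow> y \<in> subcube I a \<Longrightarrow> diff x y \<subseteq> I"
  using diff_triangle[of x y a] diff_sym[of a y] unfolding subcube_def by blast

lemma diff_outside_subcube: "y \<in> subcube I a \<Longrightarrow> diff s y - I = diff s a - I"
  using diff_triangle[of s y a] diff_triangle[of s a y] diff_sym[of a y] unfolding subcube_def by blast

lemma subcube_empty: "a \<in> V \<Longrightarrow> subcube {} a = {a}"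
  using diff_empty[of _ a] unfolding subcube_def by blast

text \<open>A vertex outside the subcube differs from all of it in some fixed coordinate, so its only
  possible neighbour there is the vertex with this coordinate corrected.\<close>

lemma convex_subcube: "convex (subcube I a)"
  unfolding convex_iff
proof (intro conjI ballI impI subcube_subset)
  fix z x y assume z: "z \<in> V" and x: "x \<in> subcube I a" and y: "y \<in> subcube I a"
    and c: "card (diff z x) = 1 \<and> card (diff z y) = 1 \<and> x \<noteq> y"
  show "z \<in> subcube I a"
  proof (rule ccontr)
    assume "z \<notin> subcube I a"
    then obtain i where i: "i \<in> {1..n} - I" "z i \<noteq> a i" using z by (auto simp: in_subcube_iff)
    then have "i \<in> diff z x" "i \<in> diff z y" using x y by (auto simp: in_subcube_iff diff_def)
    then have "diff z x = {i}" "diff z y = {i}" using c by (metis card_1_singletonE singletonD)+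
    then have "diff x y \<subseteq> {i}" using diff_triangle[of x y z] diff_sym[of x z] by auto
    moreover have "i \<notin> diff x y" using i x y by (auto simp: in_subcube_iff diff_def)
    ultimately have "diff x y = {}" by auto
    then show False using c x y subcube_subset diff_empty by blast
  qed
qed

lemma H_point: "a \<in> V \<Longrightarrow> H {a} = {a}"
  by (metis convex_subcube subcube_empty H_minimal subset_H subset_antisym order_refl)

text \<open>By induction on the number of coordinates in which \<open>z\<close> differs from \<open>a\<close>: if there are at
  least two, resetting either of two of them gives two distinct neighbours of \<open>z\<close> that are
  closer to \<open>a\<close>.\<close>

lemma lines_generate_subcube:
  assumes C: "convex C" and a: "a \<in> C" and L: "\<And>i. i \<in> M \<Longrightarrow> subcube {i} a \<subseteq> C"
  shows "subcube M a \<subseteq> C"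
proof
  fix z assume "z \<in> subcube M a"
  then show "z \<in> C"
  proof (induction "card (diff z a)" arbitrary: z rule: less_induct)
    case less
    have zV: "z \<in> V" and zM: "diff z a \<subseteq> M" using less.prems by (auto simp: subcube_def)
    have aV: "a \<in> V" using a C convex_subset by blast
    show ?case
    proof (cases "\<exists>i j. i \<in> diff z a \<and> j \<in> diff z a \<and> i \<noteq> j")
      case True
      then obtain i j where ij: "i \<in> diff z a" "j \<in> diff z a" "i \<noteq> j" by blast
      have P: "z(k := a k) \<in> C \<and> card (diff z (z(k := a k))) = 1" if k: "k \<in> diff z a" for k
      proof
        have V': "z(k := a k) \<in> V" using zV aV by (rule V_cong) auto
        have d: "diff (z(k := a k)) a = diff z a - {k}" by (auto simp: diff_def)
        then have "card (diff (z(k := a k)) a) < card (diff z a)" using k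
          by (metis card_Diff1_less finite_diff)
        moreover have "z(k := a k) \<in> subcube M a" using d V' zM by (auto simp: subcube_def)
        ultimately show "z(k := a k) \<in> C" using less.hyps by blast
        have "diff z (z(k := a k)) = {k}" using k by (auto simp: diff_def)
        then show "card (diff z (z(k := a k))) = 1" by simp
      qed
      have "z(i := a i) \<noteq> z(j := a j)" using ij by (auto simp: diff_def fun_eq_iff)
      then show ?thesis using P[OF ij(1)] P[OF ij(2)] convex_step[OF C zV] by blast
    next
      case False
      then have "diff z a = {} \<or> (\<exists>i. diff z a = {i})" by blast
      then show ?thesis
      proof
        assume "diff z a = {}" then show ?thesis using a aV zV diff_empty by blast
      next
        assume "\<exists>i. diff z a = {i}"
        then obtain i where "diff z a = {i}" ..
        then show ?thesis using L[of i] zM zV by (auto simp: subcube_def)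
      qed
    qed
  qed
qed

lemma line_in_convex:
  assumes C: "convex C" and x: "x \<in> C" and y: "y \<in> C" and d: "diff x y = {i}"
  shows "subcube {i} x \<subseteq> C"
proof
  fix z assume z: "z \<in> subcube {i} x"
  have V: "x \<in> V" "y \<in> V" "z \<in> V" using x y z C convex_subset subcube_subset by blast+
  have zx: "diff z x \<subseteq> {i}" using z by (auto simp: subcube_def)
  have zy: "diff z y \<subseteq> {i}" using zx d diff_triangle[of z y x] by auto
  show "z \<in> C"
  proof (cases "z = x \<or> z = y")
    case False
    then have "diff z x = {i}" "diff z y = {i}" using zx zy V diff_empty by blast+
    moreover have "x \<noteq> y" using d by (auto simp: diff_def)
    ultimately show ?thesis using convex_step[OF C V(3) x y] by simp
  qed (use x y in auto)
qed

text \<open>If \<open>x\<close> and \<open>y\<close> differ in two coordinates, the two other corners of the square that they span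
  are adjacent to both; so \<open>C\<close> contains the lines through \<open>x\<close> in both directions.\<close>

lemma close_pair_generates_subcube:
  assumes C: "convex C" and x: "x \<in> C" and y: "y \<in> C" and d: "card (diff x y) \<le> 2"
  shows "subcube (diff x y) x \<subseteq> C"
proof (rule lines_generate_subcube[OF C x])
  fix i assume i: "i \<in> diff x y"
  have V: "x \<in> V" "y \<in> V" using x y C convex_subset by blast+
  let ?w = "x(i := y i)"
  have wV: "?w \<in> V" using V by (rule V_cong) auto
  have wx: "diff x ?w = {i}" using i by (auto simp: diff_def)
  have wy: "diff ?w y = diff x y - {i}" by (auto simp: diff_def)
  then have "card (diff ?w y) \<le> 1" using i d by simp
  have "?w \<in> C"
  proof (cases "?w = y")
    case False
    then have "diff ?w y \<noteq> {}" using wV V diff_empty by blast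
    then have "card (diff ?w y) \<noteq> 0" by simp
    then have "card (diff ?w y) = 1" using \<open>card (diff ?w y) \<le> 1\<close> by linarith
    moreover have "card (diff ?w x) = 1" using wx diff_sym by (metis card.empty card_insert_disjoint empty_iff finite.emptyI One_nat_def)
    moreover have "x \<noteq> y" using i by (auto simp: diff_def)
    ultimately show ?thesis using convex_step[OF C wV x y] by blast
  qed (use y in auto)
  then show "subcube {i} x \<subseteq> C" using line_in_convex[OF C x _ wx] by blast
qed

text \<open>Choose \<open>x\<close> and \<open>y\<close> in the two subcubes at minimal distance, so that they agree on \<open>I \<union> J\<close>.
  They span the subcube with the free coordinates \<open>diff x y\<close>; with the lines through \<open>y\<close> in
  the directions of \<open>J\<close> this grows to a subcube through \<open>x\<close>, and so \<open>x\<close> has lines in all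
  directions.\<close>

lemma subcube_join_in_convex:
  assumes C: "convex C" and A: "subcube I a \<subseteq> C" and B: "subcube J b \<subseteq> C"
    and ab: "a \<in> V" "b \<in> V" and d: "card (diff a b - I - J) \<le> 2"
  shows "subcube (I \<union> J \<union> diff a b) a \<subseteq> C"
proof -
  \<comment> \<open>the common value on \<open>I \<union> J\<close>: that of \<open>b\<close> on \<open>I - J\<close>, and that of \<open>a\<close> on \<open>J\<close>\<close>
  define x where "x = (\<lambda>i. if i \<in> I - J then b i else a i)"
  define y where "y = (\<lambda>i. if i \<in> J then a i else b i)"
  have xV: "x \<in> V" by (rule V_cong[OF ab]) (simp add: x_def)
  have yV: "y \<in> V" by (rule V_cong[OF ab]) (simp add: y_def)
  have xA: "diff x a \<subseteq> I" and yB: "diff y b \<subseteq> J" by (auto simp: diff_def x_def y_def)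
  have D: "diff x y = diff a b - I - J" by (auto simp: diff_def x_def y_def)
  have xC: "x \<in> C" and yC: "y \<in> C" using xA yB xV yV A B by (auto simp: subcube_def)
  have pl: "subcube (diff x y) x \<subseteq> C" using close_pair_generates_subcube[OF C xC yC] d D by simp
  then have ply: "subcube (diff x y) y \<subseteq> C" using subcube_change_base[of x y "diff x y"] by simp
  have "subcube (diff x y \<union> J) y \<subseteq> C"
  proof (rule lines_generate_subcube[OF C yC])
    fix i assume "i \<in> diff x y \<union> J"
    then have "subcube {i} y \<subseteq> subcube (diff x y) y \<or> subcube {i} y \<subseteq> subcube J y" by (metis UnE empty_subsetI insert_subset subcube_mono)
    moreover have "subcube J y = subcube J b" using yB by (rule subcube_change_base)
    ultimately show "subcube {i} y \<subseteq> C" using ply B by blast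
  qed
  then have pJ: "subcube (diff x y \<union> J) x \<subseteq> C" using subcube_change_base[of x y "diff x y \<union> J"] by simp
  have "subcube (I \<union> J \<union> diff x y) x \<subseteq> C"
  proof (rule lines_generate_subcube[OF C xC])
    fix i assume "i \<in> I \<union> J \<union> diff x y"
    then have "subcube {i} x \<subseteq> subcube (diff x y \<union> J) x \<or> subcube {i} x \<subseteq> subcube I x" by (metis UnE UnI1 UnI2 empty_subsetI insert_subset subcube_mono)
    moreover have "subcube I x = subcube I a" using xA by (rule subcube_change_base)
    ultimately show "subcube {i} x \<subseteq> C" using pJ A by blast
  qed
  moreover have "I \<union> J \<union> diff x y = I \<union> J \<union> diff a b" using D by auto
  moreover have "subcube (I \<union> J \<union> diff a b) x = subcube (I \<union> J \<union> diff a b) a" using xA by (intro subcube_change_base) auto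
  ultimately show ?thesis by simp
qed

lemma H_union_subcube:
  assumes A: "H A = subcube I a" "A \<subseteq> V" "a \<in> V" and B: "H B = subcube J b" "B \<subseteq> V" "b \<in> V"
    and d: "card (diff a b - I - J) \<le> 2"
  shows "H (A \<union> B) = subcube (I \<union> J \<union> diff a b) a"
proof
  have "subcube I a \<subseteq> H (A \<union> B)" "subcube J b \<subseteq> H (A \<union> B)" using A B H_mono by (metis Un_upper1 Un_upper2)+
  then show "subcube (I \<union> J \<union> diff a b) a \<subseteq> H (A \<union> B)"
    using subcube_join_in_convex A B d convex_H by (metis Un_subset_iff)
  have "A \<subseteq> subcube I a" "B \<subseteq> subcube J b" using A B subset_H by metis+
  moreover have "subcube I a \<subseteq> subcube (I \<union> J \<union> diff a b) a" by (rule subcube_mono) auto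
  moreover have "subcube J b \<subseteq> subcube (I \<union> J \<union> diff a b) b" by (rule subcube_mono) auto
  moreover have "subcube (I \<union> J \<union> diff a b) a = subcube (I \<union> J \<union> diff a b) b" by (intro subcube_change_base) auto
  ultimately show "H (A \<union> B) \<subseteq> subcube (I \<union> J \<union> diff a b) a"
    by (intro H_minimal convex_subcube) auto
qed

lemma H_singleton: "a \<in> V \<Longrightarrow> H {a} = subcube {} a"
  by (simp add: H_point subcube_empty)

section \<open>Sets assembled by merging subcubes\<close>

text \<open>\<open>built S I a\<close> records that \<open>S\<close> can be merged, in steps joining subcubes at distance at most
  \<open>2\<close>, to the subcube with free coordinates \<open>I\<close> through \<open>a\<close>. The sets merged may overlap; this
  makes \<open>H_covered_by_built\<close> easy, and the size of a union is bounded by the sum of the sizes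
  all the same.\<close>

inductive built :: "(nat \<Rightarrow> nat) set \<Rightarrow> nat set \<Rightarrow> (nat \<Rightarrow> nat) \<Rightarrow> bool" where
  point: "a \<in> V \<Longrightarrow> built {a} {} a"
| merge: "built A I a \<Longrightarrow> built B J b \<Longrightarrow> card (diff a b - I - J) \<le> 2
    \<Longrightarrow> built (A \<union> B) (I \<union> J \<union> diff a b) a"

lemma built_props:
  "built S I a \<Longrightarrow> finite S \<and> S \<subseteq> V \<and> a \<in> V \<and> I \<subseteq> {1..n} \<and> H S = subcube I a"
proof (induction rule: built.induct)
  case (point a)
  then show ?case by (simp add: H_singleton)
next
  case (merge A I a B J b)
  then have "H (A \<union> B) = subcube (I \<union> J \<union> diff a b) a" by (intro H_union_subcube) auto
  then show ?case using merge.IH diff_subset[of a b] by (simp del: One_nat_def)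
qed

text \<open>The union of all subcubes built from subsets of \<open>S\<close> is convex: two neighbours of a vertex
  have distance at most \<open>2\<close>, so their subcubes can be merged, and the result contains the
  vertex.\<close>

lemma H_covered_by_built:
  assumes S: "S \<subseteq> V" and p: "p \<in> H S"
  shows "\<exists>T I a. T \<subseteq> S \<and> built T I a \<and> p \<in> subcube I a"
proof -
  define C where "C = {x. \<exists>T I a. T \<subseteq> S \<and> built T I a \<and> x \<in> subcube I a}"
  have "S \<subseteq> C"
  proof
    fix x assume "x \<in> S"
    then have "{x} \<subseteq> S" "built {x} {} x" "x \<in> subcube {} x" using S by (auto intro: built.point self_in_subcube)
    then show "x \<in> C" unfolding C_def by blast
  qed
  moreover have "convex C" unfolding convex_iff
  proof (intro conjI ballI impI)
    show "C \<subseteq> V" using subcube_subset unfolding C_def by blast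
    fix z x y assume z: "z \<in> V" and x: "x \<in> C" and y: "y \<in> C"
      and c: "card (diff z x) = 1 \<and> card (diff z y) = 1 \<and> x \<noteq> y"
    obtain A I a where A: "A \<subseteq> S" "built A I a" "x \<in> subcube I a" using x unfolding C_def by blast
    obtain B J b where B: "B \<subseteq> S" "built B J b" "y \<in> subcube J b" using y unfolding C_def by blast
    have "diff a b - I - J \<subseteq> diff x y" using A(3) B(3) by (auto simp: in_subcube_iff diff_def)
    also have "\<dots> \<subseteq> diff z x \<union> diff z y" using diff_triangle[of x y z] diff_sym[of x z] by simp
    finally have "card (diff a b - I - J) \<le> card (diff z x \<union> diff z y)" by (intro card_mono) auto
    also have "\<dots> \<le> 2" using c card_Un_le[of "diff z x" "diff z y"] by linarith
    finally have m: "built (A \<union> B) (I \<union> J \<union> diff a b) a" using A B by (intro built.merge)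
    have "subcube I a \<subseteq> subcube (I \<union> J \<union> diff a b) a" by (rule subcube_mono) auto
    moreover have "subcube J b \<subseteq> subcube (I \<union> J \<union> diff a b) b" by (rule subcube_mono) auto
    moreover have "subcube (I \<union> J \<union> diff a b) a = subcube (I \<union> J \<union> diff a b) b" by (intro subcube_change_base) auto
    ultimately have "x \<in> subcube (I \<union> J \<union> diff a b) a" "y \<in> subcube (I \<union> J \<union> diff a b) a" using A B by auto
    then have "z \<in> subcube (I \<union> J \<union> diff a b) a" using convex_step[OF convex_subcube z] c by blast
    then show "z \<in> C" unfolding C_def using m A(1) B(1) by blast
  qed
  ultimately have "H S \<subseteq> C" by (rule H_minimal)
  then show ?thesis using p unfolding C_def by blast
qed

section \<open>Independent sets are small\<close>

text \<open>The case of a merge in which one of the two subcubes is a point.\<close>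

lemma subcube_extend:
  assumes C: "convex C" "subcube I a \<subseteq> C" "s \<in> C" and a: "a \<in> V" and d: "card (diff s a - I) \<le> 2"
  shows "subcube (I \<union> diff s a) a \<subseteq> C"
proof -
  have s: "s \<in> V" using C convex_subset by blast
  show ?thesis using subcube_join_in_convex[of C I a "{}" s] C a s d diff_sym[of a s] subcube_empty[of s] by simp
qed

text \<open>Of the points \<open>x\<close> and \<open>y\<close> on a line in direction \<open>i\<close>, one differs from \<open>s\<close> in coordinate
  \<open>i\<close>. Together with \<open>s\<close> it spans the plane of the directions \<open>i\<close> and \<open>j\<close>, and this contains
  the other one.\<close>

lemma independent_line:
  assumes ind: "independent S" and S: "S \<subseteq> V" and xy: "x \<in> S" "y \<in> S" "diff x y = {i}"
    and s: "s \<in> S" "diff s y - {i} = {j}"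
  shows False
proof -
  have F: False if xy: "x \<in> S" "y \<in> S" "diff x y = {i}" and s: "s \<in> S" "diff s y - {i} = {j}" "s i \<noteq> x i"
    for x y
  proof -
    have "k \<in> diff x y \<longleftrightarrow> k = i" "k \<in> diff s y - {i} \<longleftrightarrow> k = j" for k
      using xy(3) s(2) by simp_all
    then have sx: "diff s x = {i, j}" using s(3) unfolding diff_def by (intro set_eqI) (metis (mono_tags, lifting) DiffD1 DiffI insert_iff mem_Collect_eq singletonD DiffD2)
    have "j \<in> diff s y" "i \<in> diff x y" using s xy by auto
    then have "s \<noteq> y" "x \<noteq> y" by (auto simp: diff_def)
    then have "subcube {i, j} s \<subseteq> H (S - {y})"
      using close_pair_generates_subcube[of "H (S - {y})" s x] sx s(1) xy(1) subset_H[of "S - {y}"] S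
        card_insert_le_m1[of 2 "{j}" i]
      by (simp add: convex_H subset_iff)
    moreover have "diff y s \<subseteq> {i, j}" using s(2) diff_sym[of y s] by auto
    then have "y \<in> subcube {i, j} s" using S xy by (auto simp: subcube_def)
    ultimately show False using ind xy(2) unfolding independent_def by blast
  qed
  show False
  proof (cases "s i = x i")
    case False then show False using F xy s by blast
  next
    case True
    have "i \<in> diff x y" using xy by auto
    then have "s i \<noteq> y i" using True by (auto simp: diff_def)
    moreover have "k \<in> diff x y \<longleftrightarrow> k = i" for k using xy(3) by simp
    then have "diff s x - {i} = diff s y - {i}" unfolding diff_def by (intro set_eqI) (metis (mono_tags, lifting) DiffD1 DiffD2 DiffI insert_iff mem_Collect_eq)
    ultimately show False using F[of y x] xy s diff_sym[of x y] by metis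
  qed
qed

text \<open>For each missing direction \<open>i \<in> N - I\<close> the set \<open>S\<close> has a point that leaves the hyperplane \<open>x
  i = a i\<close>, since \<open>S\<close> would not span the subcube otherwise. At most two such points together
  with \<open>A\<close> span everything, so by independence \<open>S\<close> has no further elements. It remains to
  compare the values of \<open>max_size\<close>; this fails for small \<open>I\<close> only, where independence has to
  be used once more.\<close>

lemma card_le_small_codim:
  assumes ind: "independent S" and S: "S \<subseteq> V" "H S = subcube N a" and a: "a \<in> V"
    and A: "A \<subseteq> S" "H A = subcube I a" and IN: "I \<subset> N" "N \<subseteq> {1..n}" "card (N - I) \<le> 2"
    and cA: "card A \<le> max_size (card I)"
  shows "card S \<le> max_size (card N)"
proof -
  have SN: "S \<subseteq> subcube N a" and AI: "A \<subseteq> subcube I a" using S A subset_H by metis+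
  have fin: "finite S" "finite A" "finite N" "finite I"
  proof -
    show "finite S" using S(1) finite_V by (rule finite_subset)
    then show "finite A" using A(1) finite_subset by blast
    show "finite N" using IN(2) by (rule finite_subset) simp
    then show "finite I" using IN(1) finite_subset by blast
  qed
  have cN: "card N = card I + card (N - I)" using fin IN
    by (metis card_Diff_subset card_mono le_add_diff_inverse psubset_imp_subset)
  have esc: "\<exists>s \<in> S. s i \<noteq> a i" if i: "i \<in> N" for i
  proof (rule ccontr)
    assume "\<not> ?thesis"
    then have "S \<subseteq> subcube (N - {i}) a" using SN unfolding in_subcube_iff subset_iff by blast
    then have "subcube N a \<subseteq> subcube (N - {i}) a" using H_minimal[OF _ convex_subcube] S(2) by metis
    moreover have "{i} \<subseteq> {1..n}" using i IN by auto
    then have "shift1 a {i} \<in> V" "diff (shift1 a {i}) a = {i}"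
      by (simp_all only: shift_in_V[OF a] diff_shift)
    then have "shift1 a {i} \<in> subcube N a" "shift1 a {i} \<notin> subcube (N - {i}) a" using i unfolding subcube_def by simp_all
    ultimately show False by blast
  qed
  have dN: "diff s a \<subseteq> N" if "s \<in> S" for s using that SN by (auto simp: subcube_def)
  have span: "S = T" if "T \<subseteq> S" "subcube N a \<subseteq> H T" for T
    using independent_spanned[OF ind that(1)] that SN by blast
  have HT: "convex (H T)" "subcube I a \<subseteq> H T" "T \<subseteq> H T" if "A \<subseteq> T" "T \<subseteq> S" for T
  proof -
    show "convex (H T)" using that(2) S(1) by (intro convex_H) auto
    show "subcube I a \<subseteq> H T" using H_mono[OF that(1)] A(2) by simp
  qed (rule subset_H)
  \<comment> \<open>a point of \<open>S\<close> at distance \<open>1\<close> from a line makes one of two points on the line superfluous;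
    this compensates for \<open>max_size 2 = max_size 1\<close> and \<open>max_size 3 = max_size 1 + 1\<close>\<close>
  have line: "card A \<le> 1" if I: "card I = 1" and s: "s \<in> S" "card (diff s a - I) = 1" for s
  proof (rule ccontr)
    assume "\<not> card A \<le> 1"
    then obtain x y where xy: "x \<in> A" "y \<in> A" "x \<noteq> y" using fin by (auto simp: card_le_Suc0_iff_eq)
    obtain i where i: "I = {i}" using I by (rule card_1_singletonE)
    obtain j where j: "diff s a - I = {j}" using s(2) by (rule card_1_singletonE)
    have "diff x y \<subseteq> {i}" using diff_subset_subcube xy(1,2) AI i by blast
    moreover have "diff x y \<noteq> {}" using xy A(1) S(1) diff_empty by blast
    ultimately have xyi: "diff x y = {i}" by blast
    have "diff s y - {i} = diff s a - I" using diff_outside_subcube xy(2) AI i by blast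
    then have syj: "diff s y - {i} = {j}" using j by simp
    have "x \<in> S" "y \<in> S" using xy A(1) by blast+
    then show False using independent_line[OF ind S(1) _ _ xyi s(1) syj] by blast
  qed
  \<comment> \<open>a single point leaving all hyperplanes completes \<open>A\<close>\<close>
  have one: "card S \<le> card A + 1" if s: "s \<in> S" "N - I \<subseteq> diff s a" for s
  proof -
    have "diff s a - I \<subseteq> N - I" using dN[OF s(1)] by blast
    then have "card (diff s a - I) \<le> 2" using IN(3) fin(3) by (meson card_mono finite_Diff le_trans)
    then have "subcube (I \<union> diff s a) a \<subseteq> H (insert s A)"
      using HT[of "insert s A"] s(1) A(1) a by (intro subcube_extend) auto
    moreover have "I \<union> diff s a = N" using s dN IN by blast
    ultimately have "S = insert s A" using span[of "insert s A"] s(1) A(1) by simp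
    then show ?thesis using card_insert_le_m1 fin(2) by (simp add: card_insert_if)
  qed
  have "N - I \<noteq> {}" using IN by blast
  then have "card (N - I) \<noteq> 0" using fin by simp
  then consider "card (N - I) = 1" | "card (N - I) = 2" using IN(3) by linarith
  then show ?thesis
  proof cases
    case 1
    then obtain i where i: "N - I = {i}" by (rule card_1_singletonE)
    then obtain s where s: "s \<in> S" "s i \<noteq> a i" using esc by blast
    have "i \<in> diff s a" using s(2) i IN(2) unfolding in_diff_iff by blast
    then have d: "N - I \<subseteq> diff s a" using i by simp
    have "diff s a - I = N - I" using d dN[OF s(1)] by blast
    then have "diff s a - I = {i}" using i by simp
    then have d1: "card (diff s a - I) = 1" by simp
    have le: "card S \<le> card A + 1" using one s(1) d by blast
    show ?thesis
    proof (cases "card I = 1")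
      case True
      have "max_size (card N) = 2" using cN 1 True by (simp add: max_size_def)
      then show ?thesis using line[OF True s(1) d1] le by linarith
    next
      case False
      then have "card I = 0 \<or> card I \<ge> 2" by linarith
      then show ?thesis using max_size_Suc[of "card I"] le cA cN 1 by auto
    qed
  next
    case 2
    then obtain i j where ij: "N - I = {i, j}" "i \<noteq> j" by (metis card_2_iff)
    obtain s where s: "s \<in> S" "s i \<noteq> a i" using esc ij by blast
    obtain t where t: "t \<in> S" "t j \<noteq> a j" using esc ij by blast
    have ijn: "i \<in> {1..n}" "j \<in> {1..n}" "i \<notin> I" "j \<notin> I" using ij IN by blast+
    have lg: "card I = 0 \<or> card I = 1 \<or> card I \<ge> 2" by linarith
    have l2: "max_size (card I) + 2 \<le> max_size (card I + 2)" if "card I \<ge> 2"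
      using that max_size_Suc[of "card I"] max_size_Suc[of "card I + 1"] by simp
    show ?thesis
    proof (cases "s j \<noteq> a j \<or> t i \<noteq> a i")
      case True
      then have "N - I \<subseteq> diff s a \<or> N - I \<subseteq> diff t a" using s(2) t(2) ijn
        unfolding ij(1) by (simp add: in_diff_iff del: One_nat_def)
      then have "card S \<le> card A + 1" using one s(1) t(1) by blast
      moreover have "max_size (card I) + 1 \<le> max_size (card I + 2)" using lg l2
        by (auto simp: max_size_def[of 0] max_size_def[of "Suc 0"] max_size_def[of "Suc (Suc 0)"] max_size_def[of "Suc (Suc (Suc 0))"])
      ultimately show ?thesis using cA cN 2 by simp
    next
      case False
      have si: "i \<in> diff s a" "j \<notin> diff s a" and ti: "j \<in> diff t a" "i \<notin> diff t a"
        using s(2) t(2) False ijn unfolding in_diff_iff by blast+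
      have "diff s a - I \<subseteq> {i, j}" "diff t a - I \<subseteq> {i, j}" using ij(1) dN[OF s(1)] dN[OF t(1)] by blast+
      then have sI: "diff s a - I = {i}" and tI: "diff t a - I = {j}" using si ti ijn by blast+
      let ?T = "insert t (insert s A)"
      have T: "?T \<subseteq> S" using s t A by blast
      have AT: "A \<subseteq> ?T" by blast
      have st: "s \<in> H ?T" "t \<in> H ?T" using HT(3)[OF AT T] by blast+
      have "card (diff s a - I) \<le> 2" using sI by simp
      then have h1: "subcube (I \<union> diff s a) a \<subseteq> H ?T" by (rule subcube_extend[OF HT(1,2)[OF AT T] st(1) a])
      have "card (diff t a - (I \<union> diff s a)) \<le> card {j}" using tI by (intro card_mono) auto
      then have "card (diff t a - (I \<union> diff s a)) \<le> 2" by simp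
      then have "subcube (I \<union> diff s a \<union> diff t a) a \<subseteq> H ?T" by (rule subcube_extend[OF HT(1)[OF AT T] h1 st(2) a])
      moreover have "I \<union> diff s a \<union> diff t a = N" using ij(1) sI tI IN dN[OF s(1)] dN[OF t(1)] by blast
      ultimately have "S = ?T" using span T by simp
      then have c2: "card S \<le> card A + 2" using fin(2) by (simp add: card_insert_if)
      show ?thesis
      proof (cases "card I = 0")
        case True
        then have I: "I = {}" using fin by simp
        \<comment> \<open>now \<open>A \<subseteq> {a}\<close>, and \<open>a\<close> is a corner of the square spanned by \<open>s\<close> and \<open>t\<close>\<close>
        have "diff s a = {i}" "diff t a = {j}" using sI tI I by auto
        then have "diff s t = {i, j}" using in_diff_iff[of _ s t] in_diff_iff[of _ s a] in_diff_iff[of _ t a] ij(2) by (intro set_eqI) (metis insert_iff singletonD)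
        then have "subcube {i, j} s \<subseteq> H {s, t}"
          using close_pair_generates_subcube[of "H {s, t}" s t] convex_H[of "{s, t}"] subset_H[of "{s, t}"] s t S(1) ij(2)
          by auto
        moreover have "a \<in> subcube {i, j} s" using sI I a diff_sym[of a s] by (auto simp: subcube_def)
        moreover have "H {s, t} \<subseteq> H (S - {a})" if "a \<in> S" using s t that by (intro H_mono) auto
        ultimately have "a \<notin> S" using ind unfolding independent_def by blast
        then have "A = {}" using AI A(1) subcube_empty[OF a] unfolding I by auto
        then have "card A = 0" by simp
        moreover have "max_size (card N) = 2" using cN 2 True by (simp add: max_size_def)
        ultimately show ?thesis using c2 by linarith
      next
        case False
        then consider "card I = 1" | "card I \<ge> 2" by linarith
        then show ?thesis
        proof cases
          case 1
          then have "card A \<le> 1" using line[OF _ s(1)] sI by simp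
          moreover have "max_size (card N) = 3" using cN \<open>card (N - I) = 2\<close> 1 by (simp add: max_size_def)
          ultimately show ?thesis using c2 by linarith
        next
          case 2
          then show ?thesis using l2 c2 cA cN \<open>card (N - I) = 2\<close> by simp
        qed
      qed
    qed
  qed
qed

text \<open>In each merge either one of the two sets spans everything and is the whole set, or
  \<open>card_le_small_codim\<close> applies to one of them, or both have codimension at least \<open>3\<close>, and
  then adding the two bounds suffices because three more dimensions double \<open>max_size\<close>.\<close>

theorem independent_built_bound:
  "built S I a \<Longrightarrow> independent S \<Longrightarrow> card S \<le> max_size (card I)"
proof (induction rule: built.induct)
  case (point a)
  then show ?case by simp
next
  case (merge A I a B J b)
  let ?N = "I \<union> J \<union> diff a b"
  let ?S = "A \<union> B"
  have A: "finite A" "A \<subseteq> V" "a \<in> V" "I \<subseteq> {1..n}" "H A = subcube I a"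
    using built_props[OF merge.hyps(1)] by auto
  have B: "finite B" "B \<subseteq> V" "b \<in> V" "J \<subseteq> {1..n}" "H B = subcube J b"
    using built_props[OF merge.hyps(2)] by auto
  have N: "?N \<subseteq> {1..n}" using A B diff_subset by blast
  have Sa: "H ?S = subcube ?N a" using H_union_subcube A B merge.hyps(3) by blast
  have Sb: "H ?S = subcube ?N b" using Sa subcube_change_base[of a b ?N] by auto
  have S: "?S \<subseteq> V" using A B by blast
  have cA: "card A \<le> max_size (card I)" using merge.IH(1) independent_subset[OF merge.prems] by blast
  have cB: "card B \<le> max_size (card J)" using merge.IH(2) independent_subset[OF merge.prems] by blast
  consider "I = ?N" | "J = ?N" | "I \<subset> ?N" "card (?N - I) \<le> 2" | "J \<subset> ?N" "card (?N - J) \<le> 2"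
    | "card (?N - I) > 2" "card (?N - J) > 2" by fastforce
  then show ?case
  proof cases
    case 1
    then have "?S \<subseteq> H A" using Sa A(5) subset_H[of ?S] by metis
    then have "?S = A" using independent_spanned[OF merge.prems] by blast
    then show ?thesis using cA 1 by metis
  next
    case 2
    then have "?S \<subseteq> H B" using Sb B(5) subset_H[of ?S] by metis
    then have "?S = B" using independent_spanned[OF merge.prems] by blast
    then show ?thesis using cB 2 by metis
  next
    case 3
    then show ?thesis using card_le_small_codim[OF merge.prems S Sa A(3) _ A(5) _ N _ cA] by blast
  next
    case 4
    then show ?thesis using card_le_small_codim[OF merge.prems S Sb B(3) _ B(5) _ N _ cB] by blast
  next
    case 5
    have "card (?N - I) = card ?N - card I" "card (?N - J) = card ?N - card J"
      using A(4) B(4) by (auto intro!: card_Diff_subset finite_subset[OF _ finite_atLeastAtMost])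
    then have le: "card I \<le> card ?N - 3" "card J \<le> card ?N - 3" "card ?N \<ge> 3" using 5 by linarith+
    have "card ?S \<le> card A + card B" by (rule card_Un_le)
    also have "\<dots> \<le> max_size (card I) + max_size (card J)" using cA cB by linarith
    also have "\<dots> \<le> 2 * max_size (card ?N - 3)"
      using monoD[OF max_size_mono le(1)] monoD[OF max_size_mono le(2)] by linarith
    also have "\<dots> \<le> max_size (card ?N)"
    proof (cases "card ?N = 3")
      case False
      then show ?thesis using double_max_size_le[of "card ?N - 3"] le(3) by simp
    qed simp
    finally show ?thesis .
  qed
qed

text \<open>A smallest \<open>F\<close> with \<open>p\<close> in its hull is independent. By \<open>H_covered_by_built\<close> some built
  subset of \<open>F\<close> has \<open>p\<close> in its hull, and by minimality it is \<open>F\<close>.\<close>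

theorem caratheodory_upper:
  assumes S: "S \<subseteq> V" and p: "p \<in> H S"
  shows "\<exists>F \<subseteq> S. finite F \<and> card F \<le> max_size n \<and> p \<in> H F"
proof -
  obtain F where F: "F \<subseteq> S" "p \<in> H F" and least: "\<And>G. G \<subseteq> S \<Longrightarrow> p \<in> H G \<Longrightarrow> card F \<le> card G"
    using ex_has_least_nat[of "\<lambda>F. F \<subseteq> S \<and> p \<in> H F" S card] S p by blast
  have FV: "F \<subseteq> V" using F(1) S by (rule order_trans)
  then have fF: "finite F" using finite_V by (rule finite_subset)
  have min: "p \<notin> H (F - {u})" if "u \<in> F" for u
    using least[of "F - {u}"] card_Diff1_less[OF fF that] F(1) by (meson Diff_subset leD order_trans)
  have ind: "independent F" unfolding independent_def
  proof (intro ballI notI)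
    fix u assume u: "u \<in> F" "u \<in> H (F - {u})"
    then have "F \<subseteq> H (F - {u})" using subset_H[of "F - {u}"] by blast
    then have "H F \<subseteq> H (F - {u})" using FV by (intro H_minimal convex_H) auto
    then show False using F(2) min u(1) by blast
  qed
  obtain T I a where T: "T \<subseteq> F" "built T I a" "p \<in> subcube I a" using H_covered_by_built[OF FV F(2)] by blast
  have pT: "p \<in> H T" "I \<subseteq> {1..n}" using built_props[OF T(2)] T(3) by simp_all
  have "F \<subseteq> T"
  proof (rule ccontr)
    assume "\<not> F \<subseteq> T"
    then obtain u where u: "u \<in> F" "u \<notin> T" by blast
    then have "H T \<subseteq> H (F - {u})" using T(1) by (intro H_mono) auto
    then show False using min u(1) pT(1) by blast
  qed
  then have "built F I a" using T by simp
  then have "card F \<le> max_size (card I)" using independent_built_bound ind by blast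
  also have "\<dots> \<le> max_size n" using monoD[OF max_size_mono card_mono[OF _ pT(2)]] by simp
  finally show ?thesis using F fF by blast
qed

section \<open>Large independent sets\<close>

definition far :: "(nat \<Rightarrow> nat) set \<Rightarrow> (nat \<Rightarrow> nat) set \<Rightarrow> bool" where
  "far X Y \<longleftrightarrow> (\<forall>x \<in> X. \<forall>y \<in> Y. 3 \<le> card (diff x y))"

lemma farI:
  assumes "\<And>x y. x \<in> X \<Longrightarrow> y \<in> Y \<Longrightarrow> {i, j, k} \<subseteq> diff x y" and "i \<noteq> j" "i \<noteq> k" "j \<noteq> k"
  shows "far X Y"
  unfolding far_def
proof (intro ballI)
  fix x y assume "x \<in> X" "y \<in> Y"
  then have "card {i, j, k} \<le> card (diff x y)" using assms(1) by (intro card_mono) auto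
  then show "3 \<le> card (diff x y)" using assms(2-4) by simp
qed

text \<open>Two neighbours of a vertex have distance at most \<open>2\<close>, so they cannot lie in different parts.\<close>

lemma convex_Un_far:
  assumes X: "convex X" and Y: "convex Y" and far: "far X Y"
  shows "convex (X \<union> Y)"
  unfolding convex_iff
proof (intro conjI ballI impI)
  show "X \<union> Y \<subseteq> V" using X Y convex_subset by blast
  fix z x y assume z: "z \<in> V" and x: "x \<in> X \<union> Y" and y: "y \<in> X \<union> Y"
    and c: "card (diff z x) = 1 \<and> card (diff z y) = 1 \<and> x \<noteq> y"
  have "card (diff x y) \<le> card (diff z x \<union> diff z y)"
    using diff_triangle[of x y z] diff_sym[of x z] by (intro card_mono) auto
  also have "\<dots> \<le> 2" using c card_Un_le[of "diff z x" "diff z y"] by linarith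
  finally have "card (diff x y) \<le> 2" "card (diff y x) \<le> 2" using diff_sym[of x y] by simp_all
  then have "\<not> (x \<in> X \<and> y \<in> Y)" "\<not> (y \<in> X \<and> x \<in> Y)"
    using far unfolding far_def by fastforce+
  then have "x \<in> X \<and> y \<in> X \<or> x \<in> Y \<and> y \<in> Y" using x y by blast
  then show "z \<in> X \<union> Y" using convex_step[OF X z, of x y] convex_step[OF Y z, of x y] c by blast
qed

text \<open>When \<open>u\<close> is removed from one part, what remains of its hull is far from the other part, so
  nothing merges and the hull stays in the union of the two hulls.\<close>

lemma H_remove_from_union:
  assumes S: "S \<subseteq> V" and T: "T \<subseteq> V" and G: "H S \<subseteq> G" "H T \<subseteq> G"
    and fS: "\<And>u. u \<in> S \<Longrightarrow> far (H (S - {u})) (H T)"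
    and fT: "\<And>u. u \<in> T \<Longrightarrow> far (H (T - {u})) (H S)"
    and u: "u \<in> S \<union> T"
  shows "H (S \<union> T - {u}) \<subseteq> G"
proof -
  have *: "H (A \<union> B - {u}) \<subseteq> H A \<union> H B"
    if A: "A \<subseteq> V" and B: "B \<subseteq> V" and u: "u \<in> A" and f: "far (H (A - {u})) (H B)" for A B
  proof -
    have "convex (H (A - {u}) \<union> H B)" using A B f by (intro convex_Un_far convex_H) auto
    moreover have "A \<union> B - {u} \<subseteq> H (A - {u}) \<union> H B"
      using subset_H[of "A - {u}"] subset_H[of B] by blast
    ultimately have "H (A \<union> B - {u}) \<subseteq> H (A - {u}) \<union> H B" by (intro H_minimal)
    then show ?thesis using H_mono[of "A - {u}" A] by blast
  qed
  show ?thesis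
  proof (cases "u \<in> S")
    case True
    then show ?thesis using *[OF S T True fS[OF True]] G by blast
  next
    case False
    then have "u \<in> T" using u by blast
    then show ?thesis using *[OF T S \<open>u \<in> T\<close> fT[OF \<open>u \<in> T\<close>]] G by (metis Un_commute Un_least order_trans)
  qed
qed

text \<open>The vertices of the subcube with \<open>x d = b d\<close> for some \<open>d \<in> D\<close> are in the hull of \<open>S\<close>, but
  removing any element of \<open>S\<close> loses all of them; \<open>b\<close> fixes these hyperplanes as well as the
  position of the subcube.\<close>

definition guards :: "(nat \<Rightarrow> nat) set \<Rightarrow> nat set \<Rightarrow> nat set \<Rightarrow> (nat \<Rightarrow> nat) \<Rightarrow> bool" where
  "guards S I D b \<longleftrightarrow> S \<subseteq> V \<and> H S = subcube I b \<and> (\<forall>u \<in> S. H (S - {u}) \<subseteq> {x. \<forall>d \<in> D. x d \<noteq> b d})"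

text \<open>The quantification over all free coordinates \<open>I\<close>, all \<open>D\<close> and all \<open>b\<close> states once and for
  all that only the numbers of coordinates matter, so that smaller configurations can be
  placed anywhere in the constructions below.\<close>

definition guarded :: "nat \<Rightarrow> nat \<Rightarrow> nat \<Rightarrow> bool" where
  "guarded m q k \<longleftrightarrow> (\<forall>I D b. I \<subseteq> {1..n} \<and> card I = m \<and> D \<subseteq> I \<and> card D = q \<and> b \<in> V \<longrightarrow>
     (\<exists>S. guards S I D b \<and> card S = k))"

lemma guardedE:
  assumes "guarded m q k" "I \<subseteq> {1..n}" "card I = m" "D \<subseteq> I" "card D = q" "b \<in> V"
  obtains S where "S \<subseteq> V" "card S = k" "H S = subcube I b"
    "\<And>u x d. u \<in> S \<Longrightarrow> x \<in> H (S - {u}) \<Longrightarrow> d \<in> D \<Longrightarrow> x d \<noteq> b d"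
proof -
  obtain S where S: "guards S I D b" "card S = k" using assms unfolding guarded_def by blast
  then have "S \<subseteq> V" "H S = subcube I b" and g: "\<forall>u \<in> S. H (S - {u}) \<subseteq> {x. \<forall>d \<in> D. x d \<noteq> b d}"
    unfolding guards_def by simp_all
  moreover have "x d \<noteq> b d" if "u \<in> S" "x \<in> H (S - {u})" "d \<in> D" for u x d
  proof -
    have "H (S - {u}) \<subseteq> {x. \<forall>d \<in> D. x d \<noteq> b d}" using g that(1) by (rule bspec)
    then have "x \<in> {x. \<forall>d \<in> D. x d \<noteq> b d}" using that(2) by (rule subsetD)
    then show ?thesis using that(3) by simp
  qed
  ultimately show thesis using that S(2) by blast
qed

lemma guardsI:
  assumes "S \<subseteq> V" "H S = subcube I b" "\<And>u. u \<in> S \<Longrightarrow> H (S - {u}) \<subseteq> {x. \<forall>d \<in> D. x d \<noteq> b d}"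
  shows "guards S I D b"
  using assms unfolding guards_def by simp

lemma guarded_fewer:
  assumes g: "guarded m 2 k" and m: "2 \<le> m"
  shows "guarded m 1 k"
  unfolding guarded_def
proof (intro allI impI, elim conjE)
  fix I D b assume I: "I \<subseteq> {1..n}" "card I = m" "D \<subseteq> I" "card D = 1" "b \<in> V"
  obtain d where d: "D = {d}" using I(4) by (rule card_1_singletonE)
  have "\<not> I \<subseteq> {d}" using I(2) m card_mono[of "{d}" I] by auto
  then obtain e where e: "e \<in> I" "e \<noteq> d" by blast
  then have de: "{d, e} \<subseteq> I" "card {d, e} = 2" using d I(3) by auto
  obtain S where S: "S \<subseteq> V" "card S = k" "H S = subcube I b"
    "\<And>u x c. u \<in> S \<Longrightarrow> x \<in> H (S - {u}) \<Longrightarrow> c \<in> {d, e} \<Longrightarrow> x c \<noteq> b c"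
    using guardedE[OF g I(1,2) de I(5)] by metis
  have "guards S I D b" by (rule guardsI[OF S(1,3)]) (use S(4) d in blast)
  then show "\<exists>S. guards S I D b \<and> card S = k" using S(2) by blast
qed

text \<open>Two vertices that differ from each other and from \<open>b\<close> in all coordinates of \<open>I\<close>. A third
  value in each coordinate is needed here.\<close>

lemma guarded_pair:
  assumes m: "m \<le> 2" "m \<noteq> 0"
  shows "guarded m m 2"
  unfolding guarded_def
proof (intro allI impI, elim conjE)
  fix I D b assume I: "I \<subseteq> {1..n}" "card I = m" "D \<subseteq> I" "card D = m" "b \<in> V"
  have "finite I" using I(1) by (rule finite_subset) simp
  then have D: "D = I" using I by (intro card_subset_eq) auto
  let ?x = "shift1 b I" and ?y = "shift2 b I"
  note V = shift_in_V[OF I(5,1)] and d = diff_shift[OF I(1), of b]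
  have "I \<noteq> {}" using I(2) m(2) by auto
  then have ne: "?x \<noteq> ?y" using shift_neq(3)[of _ I b] by (metis all_not_in_conv)
  have "H ({?x} \<union> {?y}) = subcube ({} \<union> {} \<union> diff ?x ?y) ?x"
    using V d I(2) m(1) by (intro H_union_subcube H_singleton) auto
  then have H: "H {?x, ?y} = subcube I b" using d subcube_change_base[of ?x b I] by (simp add: insert_commute)
  have rest: "{?x, ?y} - {?x} = {?y}" "{?x, ?y} - {?y} = {?x}" using ne by auto
  have "guards {?x, ?y} I D b"
  proof (rule guardsI[OF _ H])
    show "{?x, ?y} \<subseteq> V" using V by simp
    have G: "{?x} \<subseteq> {x. \<forall>d \<in> D. x d \<noteq> b d}" "{?y} \<subseteq> {x. \<forall>d \<in> D. x d \<noteq> b d}"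
      using shift_neq(1,2)[of _ I b] unfolding D by simp_all
    fix u assume "u \<in> {?x, ?y}"
    then consider "u = ?x" | "u = ?y" by blast
    then show "H ({?x, ?y} - {u}) \<subseteq> {x. \<forall>d \<in> D. x d \<noteq> b d}"
      by cases (simp_all only: rest H_point[OF V(1)] H_point[OF V(2)] G)
  qed
  moreover have "card {?x, ?y} = 2" using ne by simp
  ultimately show "\<exists>S. guards S I D b \<and> card S = 2" by blast
qed

text \<open>Free coordinates \<open>I - D - {j}\<close> and \<open>I - D - {i}\<close> for the two halves, guarded in \<open>i\<close> and \<open>j\<close>.
  The halves differ in the two coordinates of \<open>D\<close>, and these have values other than those of
  \<open>b\<close>. After removing a point from the first half, coordinate \<open>i\<close> is a third difference, since
  \<open>b i\<close> is the value that the second half has there and that the hull of the rest of the first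
  half avoids.\<close>

lemma guarded_double:
  assumes g: "guarded m 1 k" and m: "1 \<le> m"
  shows "guarded (m + 3) 2 (2 * k)"
  unfolding guarded_def
proof (intro allI impI, elim conjE)
  fix I D b assume I: "I \<subseteq> {1..n}" "card I = m + 3" "D \<subseteq> I" "card D = 2" "b \<in> V"
  obtain d e where de: "D = {d, e}" "d \<noteq> e" using I(4) by (metis card_2_iff)
  have fI: "finite I" using I(1) by (rule finite_subset) simp
  have cID: "card (I - D) = m + 1" using I fI finite_subset[of D I] by (simp add: card_Diff_subset)
  then have "\<not> card (I - D) \<le> Suc 0" using m by simp
  then obtain i j where ij: "i \<in> I - D" "j \<in> I - D" "i \<noteq> j" using fI by (auto simp: card_le_Suc0_iff_eq)
  let ?I = "I - D - {j}" and ?J = "I - D - {i}"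
  let ?a = "shift1 b D" and ?b = "shift2 b D"
  have Dn: "D \<subseteq> {1..n}" using I by blast
  note V = shift_in_V[OF I(5) Dn] and df = diff_shift[OF Dn, of b]
  have cI: "?I \<subseteq> {1..n}" "card ?I = m" "{i} \<subseteq> ?I" "card {i} = 1" and cJ: "?J \<subseteq> {1..n}" "card ?J = m" "{j} \<subseteq> ?J" "card {j} = 1"
    using I(1) cID ij fI by auto
  obtain S where S: "S \<subseteq> V" "card S = k" "H S = subcube ?I ?a"
    "\<And>u x d. u \<in> S \<Longrightarrow> x \<in> H (S - {u}) \<Longrightarrow> d \<in> {i} \<Longrightarrow> x d \<noteq> ?a d" using guardedE[OF g cI V(1)] by metis
  obtain T where T: "T \<subseteq> V" "card T = k" "H T = subcube ?J ?b"
    "\<And>u x d. u \<in> T \<Longrightarrow> x \<in> H (T - {u}) \<Longrightarrow> d \<in> {j} \<Longrightarrow> x d \<noteq> ?b d" using guardedE[OF g cJ V(2)] by metis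
  have in_n: "i \<in> {1..n}" "j \<in> {1..n}" "d \<in> {1..n}" "e \<in> {1..n}" using I(1) ij Dn de by blast+
  have dD: "d \<in> D" "e \<in> D" using de by auto
  have xS: "x c = ?a c" if "x \<in> H S" "c \<in> D \<union> {j}" for x c
    using that in_n de unfolding S(3) in_subcube_iff by blast
  have xT: "x c = ?b c" if "x \<in> H T" "c \<in> D \<union> {i}" for x c
    using that in_n de unfolding T(3) in_subcube_iff by blast
  have fS: "far (H (S - {u})) (H T)" if u: "u \<in> S" for u
  proof (rule farI[where i = i and j = d and k = e])
    fix x y assume x: "x \<in> H (S - {u})" and y: "y \<in> H T"
    then have xHS: "x \<in> H S" using H_mono[of "S - {u}" S] by blast
    have "x i \<noteq> y i" using S(4)[OF u x] xT[OF y] shift_eq[of i D b] ij by simp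
    moreover have "x d \<noteq> y d" "x e \<noteq> y e" using xS[OF xHS] xT[OF y] shift_neq(3) dD by simp_all
    ultimately show "{i, d, e} \<subseteq> diff x y" using in_n unfolding in_diff_iff insert_subset by blast
  qed (use ij de in auto)
  have fT: "far (H (T - {u})) (H S)" if u: "u \<in> T" for u
  proof (rule farI[where i = j and j = d and k = e])
    fix x y assume x: "x \<in> H (T - {u})" and y: "y \<in> H S"
    then have xHT: "x \<in> H T" using H_mono[of "T - {u}" T] by blast
    have "x j \<noteq> y j" using T(4)[OF u x] xS[OF y] shift_eq[of j D b] ij by simp
    moreover have "x d \<noteq> y d" "x e \<noteq> y e"
      using xT[OF xHT] xS[OF y] shift_neq(3)[THEN not_sym] dD by simp_all
    ultimately show "{j, d, e} \<subseteq> diff x y" using in_n unfolding in_diff_iff insert_subset by blast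
  qed (use ij de in auto)
  have "H S \<subseteq> {x. \<forall>d \<in> D. x d \<noteq> b d}"
  proof (intro subsetI CollectI ballI)
    fix x c assume "x \<in> H S" "c \<in> D"
    then show "x c \<noteq> b c" using xS[of x c] shift_neq(1)[of c D b] by simp
  qed
  moreover have "H T \<subseteq> {x. \<forall>d \<in> D. x d \<noteq> b d}"
  proof (intro subsetI CollectI ballI)
    fix x c assume "x \<in> H T" "c \<in> D"
    then show "x c \<noteq> b c" using xT[of x c] shift_neq(2)[of c D b] by simp
  qed
  ultimately have guard: "\<And>u. u \<in> S \<union> T \<Longrightarrow> H (S \<union> T - {u}) \<subseteq> {x. \<forall>d \<in> D. x d \<noteq> b d}"
    by (rule H_remove_from_union[OF S(1) T(1) _ _ fS fT])
  have "card (diff ?a ?b - ?I - ?J) \<le> 2" using df(3) I(4) by (metis card_mono Diff_subset finite_Diff finite_diff order_trans)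
  then have "H (S \<union> T) = subcube (?I \<union> ?J \<union> diff ?a ?b) ?a" using S T V by (intro H_union_subcube)
  moreover have "?I \<union> ?J \<union> diff ?a ?b = I" using df(3) ij(3) I(3) by blast
  moreover have "subcube I ?a = subcube I b" using df(1) I(3) by (intro subcube_change_base) simp
  ultimately have HST: "H (S \<union> T) = subcube I b" by simp
  have "S \<inter> T = {}"
  proof (rule ccontr)
    assume "S \<inter> T \<noteq> {}"
    then obtain x where "x \<in> H S" "x \<in> H T" using subset_H by blast
    then have "?a d = ?b d" using xS[of x d] xT[of x d] dD by simp
    then show False using shift_neq(3)[OF dD(1)] by simp
  qed
  then have "card (S \<union> T) = 2 * k" using S T finite_subset[OF _ finite_V] by (simp add: card_Un_disjoint)
  moreover have "guards (S \<union> T) I D b" using S(1) T(1) by (intro guardsI[OF _ HST guard]) simp_all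
  ultimately show "\<exists>S. guards S I D b \<and> card S = 2 * k" by blast
qed

text \<open>The new point differs from \<open>b\<close> in the new coordinate \<open>f\<close> only, and there also from the old
  set. It is adjacent to a vertex of the subcube spanned by the old set, but if a point of the
  old set is removed, the two guard coordinates push the distance up to \<open>3\<close>.\<close>

lemma guarded_insert:
  assumes g: "guarded m 2 k" and m: "2 \<le> m"
  shows "guarded (m + 1) 1 (k + 1)"
  unfolding guarded_def
proof (intro allI impI, elim conjE)
  fix I D b assume I: "I \<subseteq> {1..n}" "card I = m + 1" "D \<subseteq> I" "card D = 1" "b \<in> V"
  obtain f where f: "D = {f}" using I(4) by (rule card_1_singletonE)
  have fI: "finite I" using I(1) by (rule finite_subset) simp
  let ?I = "I - D"
  have cI: "?I \<subseteq> {1..n}" "card ?I = m" using I fI finite_subset[of D I] by (auto simp: card_Diff_subset)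
  then have "\<not> card ?I \<le> Suc 0" using m by simp
  then obtain d e where de: "d \<in> ?I" "e \<in> ?I" "d \<noteq> e" using fI by (auto simp: card_le_Suc0_iff_eq)
  have dde: "{d, e} \<subseteq> ?I" "card {d, e} = 2" using de by auto
  let ?a = "shift1 b D" and ?b = "shift2 b D"
  have Dn: "D \<subseteq> {1..n}" using I by blast
  note V = shift_in_V[OF I(5) Dn] and df = diff_shift[OF Dn, of b]
  obtain S where S: "S \<subseteq> V" "card S = k" "H S = subcube ?I ?a"
    "\<And>u x c. u \<in> S \<Longrightarrow> x \<in> H (S - {u}) \<Longrightarrow> c \<in> {d, e} \<Longrightarrow> x c \<noteq> ?a c" using guardedE[OF g cI dde V(1)] by metis
  have in_n: "d \<in> {1..n}" "e \<in> {1..n}" "f \<in> {1..n}" using I(1) de Dn f by blast+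
  have xS: "x f = ?a f" if "x \<in> H S" for x
    using that in_n f unfolding S(3) in_subcube_iff by blast
  have fD: "f \<in> D" using f by simp
  have fS: "far (H (S - {u})) (H {?b})" if u: "u \<in> S" for u
  proof (rule farI[where i = f and j = d and k = e])
    fix x y assume x: "x \<in> H (S - {u})" and "y \<in> H {?b}"
    then have y: "y = ?b" using H_point[OF V(2)] by simp
    have xHS: "x \<in> H S" using x H_mono[of "S - {u}" S] by blast
    have "x f \<noteq> y f" using xS[OF xHS] y shift_neq(3)[OF fD] by simp
    moreover have "x d \<noteq> y d" "x e \<noteq> y e"
      using S(4)[OF u x, of d] S(4)[OF u x, of e] y shift_eq[of d D b] shift_eq[of e D b] de by simp_all
    ultimately show "{f, d, e} \<subseteq> diff x y" using in_n unfolding in_diff_iff insert_subset by blast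
  qed (use de f in auto)
  have "convex {}" by (simp add: P3_convex_def)
  then have "H {} = {}" using H_minimal[of "{}" "{}"] by blast
  then have fT: "far (H ({?b} - {u})) (H S)" if "u \<in> {?b}" for u
    using that by (simp add: far_def)
  have "H S \<subseteq> {x. \<forall>d \<in> D. x d \<noteq> b d}"
  proof (intro subsetI CollectI ballI)
    fix x c assume "x \<in> H S" "c \<in> D"
    then show "x c \<noteq> b c" using xS[of x] shift_neq(1)[OF fD, of b] f by simp
  qed
  moreover have "H {?b} \<subseteq> {x. \<forall>d \<in> D. x d \<noteq> b d}"
    using shift_neq(2)[of _ D b] by (simp add: H_point[OF V(2)])
  moreover have "{?b} \<subseteq> V" using V(2) by simp
  ultimately have guard: "H (S \<union> {?b} - {u}) \<subseteq> {x. \<forall>d \<in> D. x d \<noteq> b d}" if "u \<in> S \<union> {?b}" for u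
    using H_remove_from_union[OF S(1) _ _ _ fS fT that] by simp
  have "card (diff ?a ?b - ?I - {}) \<le> 2" using df(3) I(4) card_mono[of D "D - ?I - {}"] f by simp
  then have "H (S \<union> {?b}) = subcube (?I \<union> {} \<union> diff ?a ?b) ?a"
    using S V by (intro H_union_subcube H_singleton) auto
  moreover have "?I \<union> {} \<union> diff ?a ?b = I" using df(3) I(3) by blast
  moreover have "subcube I ?a = subcube I b" using df(1) I(3) by (intro subcube_change_base) simp
  ultimately have HST: "H (S \<union> {?b}) = subcube I b" by simp
  have "?b \<notin> S"
  proof
    assume "?b \<in> S"
    then have "?b f = ?a f" using xS subset_H[of S] by blast
    then show False using shift_neq(3)[OF fD, of b] by simp
  qed
  then have "card (S \<union> {?b}) = k + 1" using S finite_subset[OF _ finite_V] by simp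
  moreover have "guards (S \<union> {?b}) I D b" using S(1) V(2) by (intro guardsI[OF _ HST guard]) simp_all
  ultimately show "\<exists>S. guards S I D b \<and> card S = k + 1" by blast
qed

text \<open>The values \<open>3\<close> and \<open>5\<close> in dimensions \<open>3\<close> and \<open>5\<close> come from adding a point in dimensions \<open>2\<close>
  and \<open>4\<close>, the value \<open>4\<close> in dimension \<open>4\<close> from doubling two points on a line.\<close>

lemma guarded_max_size:
  assumes "s < 3"
  shows "guarded (3 * q + 3 + s) 1 (max_size (3 * q + 3 + s))"
proof (induction q)
  case 0
  have three: "guarded 3 1 3" using guarded_insert[OF guarded_pair[of 2]] by (simp add: numeral_3_eq_3)
  have four: "guarded 4 2 4" using guarded_double[OF guarded_pair[of 1]] by simp
  have five: "guarded 5 1 5" using guarded_insert[OF four] by simp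
  consider "s = 0" | "s = 1" | "s = 2" using assms by linarith
  then show ?case
  proof cases
    case 1 then show ?thesis using three by simp
  next
    case 2 then show ?thesis using guarded_fewer[OF four] by simp
  next
    case 3 then show ?thesis using five by simp
  qed
next
  case (Suc q)
  have "guarded (3 * q + 3 + s + 3) 1 (2 * max_size (3 * q + 3 + s))"
    by (intro guarded_fewer guarded_double Suc) simp_all
  moreover have "3 * Suc q + 3 + s = 3 * q + 3 + s + 3" by simp
  moreover have "max_size (3 * q + 3 + s + 3) = 2 * max_size (3 * q + 3 + s)" by (rule max_size_add3) simp
  ultimately show ?case by (simp only:)
qed

text \<open>The point \<open>b\<close> lies on all hyperplanes of its own guard condition, so it is a point of the
  hull that no proper subset of the guarded set reaches.\<close>

theorem caratheodory_number_eq_max_size: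
  assumes n: "3 \<le> n"
  shows "caratheodory_number (hamming_graph n r) = max_size n"
proof -
  let ?P = "\<lambda>c. \<forall>S p. S \<subseteq> V \<and> p \<in> H S \<longrightarrow> (\<exists>F \<subseteq> S. finite F \<and> card F \<le> c \<and> p \<in> H F)"
  have "n = 3 * (n div 3 - 1) + 3 + n mod 3" using n div_mult_mod_eq[of n 3] by linarith
  then have g: "guarded n 1 (max_size n)"
    using guarded_max_size[of "n mod 3" "n div 3 - 1"] by (metis mod_less_divisor zero_less_numeral)
  define b where "b = (\<lambda>i\<in>{1..n}. 0 :: nat)"
  have "0 < r i" if "i \<in> {1..n}" for i using r3[OF that] by linarith
  then have b: "b \<in> V" unfolding V_def b_def by auto
  have I: "{1..n} \<subseteq> {1..n}" "card {1..n} = n" "{1} \<subseteq> {1..n}" "card {1::nat} = 1" using n by auto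
  obtain S where S: "S \<subseteq> V" "card S = max_size n" "H S = subcube {1..n} b"
    "\<And>u x d. u \<in> S \<Longrightarrow> x \<in> H (S - {u}) \<Longrightarrow> d \<in> {1} \<Longrightarrow> x d \<noteq> b d"
    using guardedE[OF g I b] by metis
  have bS: "b \<in> H S" using self_in_subcube[OF b] S(3) by simp
  have lower: "max_size n \<le> c" if c: "?P c" for c
  proof -
    obtain F where F: "F \<subseteq> S" "card F \<le> c" "b \<in> H F" using c S(1) bS by blast
    have "F = S"
    proof (rule ccontr)
      assume "F \<noteq> S"
      then obtain u where "u \<in> S" "u \<notin> F" using F(1) by blast
      then have "b \<in> H (S - {u})" using F(1,3) H_mono[of F "S - {u}"] by blast
      then show False using S(4)[OF \<open>u \<in> S\<close>, of b 1] by simp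
    qed
    then show ?thesis using F(2) S(2) by simp
  qed
  have upper: "?P (max_size n)" using caratheodory_upper by blast
  show ?thesis unfolding caratheodory_number_def pverts_hamming
    using upper lower by (rule Least_equality)
qed

end

theorem theorem4p1:
  fixes n :: nat and r :: "nat \<Rightarrow> nat"
  assumes "n \<ge> 7"
    and "\<forall>i \<in> {1..n}. r i \<ge> 3"
  shows "(n mod 3 = 0 \<longrightarrow>
            caratheodory_number (hamming_graph n r) = 3 * 2 ^ (n div 3 - 1)) \<and>
         (n mod 3 = 1 \<longrightarrow>
            caratheodory_number (hamming_graph n r) = 4 * 2 ^ ((n - 1) div 3 - 1)) \<and>
         (n mod 3 = 2 \<longrightarrow>
            caratheodory_number (hamming_graph n r) = 5 * 2 ^ ((n - 2) div 3 - 1))"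
proof -
  interpret hamming n r using assms(2) by unfold_locales blast
  have eq: "caratheodory_number (hamming_graph n r) = (3 + n mod 3) * 2 ^ (n div 3 - 1)"
    using caratheodory_number_eq_max_size assms(1) by (simp add: max_size_def)
  have "n mod 3 = 1 \<Longrightarrow> (n - 1) div 3 = n div 3" "n mod 3 = 2 \<Longrightarrow> (n - 2) div 3 = n div 3"
    using assms(1) by presburger+
  then show ?thesis using eq by simp
qed

end
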